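(* If $c_l$ is increasing and convex for all $l\in L$, and $M$ is supermodular and nondecreasing, then the objective function $S\mapsto J(\mathcal{C}_S)$, $S\subseteq L$, is supermodular.
   Context: Reverse auction with different types of goods. $L$ is a finite set of bidders, $[t]=\{1,\dots,t\}$ the set of types, and $\{A^\tau\}_{\tau=1}^t$ a partition of $L$, where $A^\tau$ is the set of bidders bidding for goods of type $\tau$; for $T\subseteq[t]$, $A^T=\bigcup_{\tau\in T}A^\tau$. Each bidder $l\in L$ has a cost function $c_l:\mathbb{R}_+\to\mathbb{R}_+$ with $c_l(0)=0$ and a capacity $\bar X_l\in\mathbb{R}_+$. The function $M:2^{[t]}\to\mathbb{R}_+$ satisfies $M(\emptyset)=0$. For $S\subseteq L$, $$J(\mathcal{C}_S)=\min_{x\in\mathbb{R}_+^{|L|}}\ \sum_{l\in S}c_l(x_l)\quad\text{s.t. }\sum_{l\in A^T}x_l\ge M(T)\ \ \forall T\subseteq[t],\quad x_l\le\bar X_l\ \ \forall l\in L,\quad x_l=0\ \ \forall l\in L\setminus S,$$ with value $+\infty$ if the problem is infeasible. A set function $f:2^N\to\mathbb{R}\cup\{+\infty\}$ on a finite set $N$ is supermodular if $f(S\cup R)+f(S\cap R)\ge f(S)+f(R)$ for all $S,R\subseteq N$ (for finite-valued $f$ this is equivalent to $f(S)-f(S\setminus\{l\})\le f(R)-f(R\setminus\{l\})$ for all $S\subseteq R\subseteq N$, $l\in S$). It is nondecreasing if $f(S')\le f(S)$ whenever $S'\subseteq S$. *)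

theory Defs
  imports "HOL-Analysis.Analysis"
begin

definition supermodular_on :: "'b set \<Rightarrow> ('b set \<Rightarrow> 'v::{plus,ord}) \<Rightarrow> bool" where
  "supermodular_on N f \<longleftrightarrow>
     (\<forall>S R. S \<subseteq> N \<longrightarrow> R \<subseteq> N \<longrightarrow> f S + f R \<le> f (S \<union> R) + f (S \<inter> R))"

text \<open>
  Vectors indexed by the finite set \<open>L\<close> are represented by functions that vanish outside \<open>L\<close>.
\<close>

definition feasible_allocations ::
  "'a set \<Rightarrow> nat \<Rightarrow> (nat \<Rightarrow> 'a set) \<Rightarrow> ('a \<Rightarrow> real) \<Rightarrow> (nat set \<Rightarrow> real) \<Rightarrow> 'a set \<Rightarrow> ('a \<Rightarrow> real) set" where
  "feasible_allocations L t A X M S =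
     {x. (\<forall>l. l \<notin> L \<longrightarrow> x l = 0)
       \<and> (\<forall>l\<in>L. 0 \<le> x l)
       \<and> (\<forall>T. T \<subseteq> {1..t} \<longrightarrow> M T \<le> (\<Sum>l\<in>(\<Union>\<tau>\<in>T. A \<tau>). x l))
       \<and> (\<forall>l\<in>L. x l \<le> X l)
       \<and> (\<forall>l\<in>L - S. x l = 0)}"

text \<open>
  The infimum over the empty set is \<open>\<infinity>\<close> in \<^typ>\<open>ereal\<close>, which is the intended value of an
  infeasible problem.  For nonnegative convex costs that vanish at 0, the infimum over a nonempty
  feasible set is a minimum; see \<open>auction_cost_attained\<close> below.
\<close>

definition auction_cost ::
  "'a set \<Rightarrow> nat \<Rightarrow> (nat \<Rightarrow> 'a set) \<Rightarrow> ('a \<Rightarrow> real) \<Rightarrow> (nat set \<Rightarrow> real) \<Rightarrow> ('a \<Rightarrow> real \<Rightarrow> real)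
     \<Rightarrow> 'a set \<Rightarrow> ereal" where
  "auction_cost L t A X M c S =
     (INF x\<in>feasible_allocations L t A X M S. ereal (\<Sum>l\<in>S. c l (x l)))"

lemma auction_cost_infeasible:
  "feasible_allocations L t A X M S = {} \<Longrightarrow> auction_cost L t A X M c S = \<infinity>"
  by (simp add: auction_cost_def top_ereal_def)

lemma convex_on_nonneg_continuous:
  fixes f :: "real \<Rightarrow> real"
  assumes cvx: "convex_on {0..} f" and nn: "\<And>x. 0 \<le> x \<Longrightarrow> 0 \<le> f x" and z: "f 0 = 0"
  shows "continuous_on {0..} f"
proof -
  have up: "f x \<le> x * f 1" if "0 \<le> x" "x \<le> 1" for x
    using convex_onD[OF cvx, of x 0 1] that z by auto
  have "convex_on {0<..} f"
    by (rule convex_on_subset[OF cvx]) auto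
  then have "continuous_on {0<..} f"
    by (intro convex_on_continuous) auto
  then have pos: "continuous (at x within {0..}) f" if "0 < x" for x
    using that by (metis continuous_at_imp_continuous_at_within continuous_on_eq_continuous_at
        greaterThan_iff open_greaterThan)
  have ev: "\<forall>\<^sub>F x in at 0 within {0..}. 0 \<le> x \<and> x \<le> (1::real)"
    unfolding eventually_at by (rule exI[of _ 1]) auto
  have "(f \<longlongrightarrow> 0) (at 0 within {0..})"
  proof (rule tendsto_sandwich)
    show "\<forall>\<^sub>F x in at 0 within {0..}. 0 \<le> f x"
      using ev by eventually_elim (use nn in auto)
    show "\<forall>\<^sub>F x in at 0 within {0..}. f x \<le> x * f 1"
      using ev by eventually_elim (use up in auto)
    show "((\<lambda>x. x * f 1) \<longlongrightarrow> 0) (at (0::real) within {0..})"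
      by (auto intro!: tendsto_eq_intros)
  qed simp
  then have "continuous (at 0 within {0..}) f"
    by (simp add: continuous_within z)
  with pos show ?thesis
    by (auto simp: continuous_on_eq_continuous_within order_le_less)
qed

lemma auction_cost_attained:
  assumes SL: "S \<subseteq> L"
    and c0: "\<And>l. l \<in> L \<Longrightarrow> c l 0 = 0"
    and cnn: "\<And>l x. l \<in> L \<Longrightarrow> 0 \<le> x \<Longrightarrow> 0 \<le> c l x"
    and cvx: "\<And>l. l \<in> L \<Longrightarrow> convex_on {0..} (c l)"
    and ne: "feasible_allocations L t A X M S \<noteq> {}"
  obtains x where "x \<in> feasible_allocations L t A X M S"
    and "auction_cost L t A X M c S = ereal (\<Sum>l\<in>S. c l (x l))"
    and "\<And>y. y \<in> feasible_allocations L t A X M S \<Longrightarrow> (\<Sum>l\<in>S. c l (x l)) \<le> (\<Sum>l\<in>S. c l (y l))"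
proof -
  let ?F = "feasible_allocations L t A X M S"
  let ?g = "\<lambda>x. \<Sum>l\<in>S. c l (x l)"
  define B where "B = Pi\<^sub>E UNIV (\<lambda>l. if l \<in> L then {0..X l} else {0::real})"
  have "compactin (product_topology (\<lambda>l. euclidean) UNIV) B"
    unfolding B_def by (subst compactin_PiE) auto
  then have cB: "compact B"
    by (simp add: euclidean_product_topology)
  let ?C = "{x. (\<forall>T. T \<subseteq> {1..t} \<longrightarrow> M T \<le> (\<Sum>l\<in>(\<Union>\<tau>\<in>T. A \<tau>). x l)) \<and> (\<forall>l\<in>L - S. x l = 0)}"
  have coord: "continuous_on U (\<lambda>x::'a \<Rightarrow> real. x l)" for U l
    by (rule continuous_on_subset[OF continuous_on_product_coordinates]) auto
  have clC: "closed ?C"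
    unfolding Ball_def
    by (intro closed_Collect_conj closed_Collect_all closed_Collect_imp open_Collect_const
        closed_Collect_le closed_Collect_eq continuous_intros coord)
  have F_eq: "?F = B \<inter> ?C"
    unfolding feasible_allocations_def B_def by (fastforce simp: PiE_iff split: if_splits)
  then have "compact ?F"
    using cB clC by (simp add: compact_Int_closed)
  moreover have "continuous_on ?F ?g"
  proof (intro continuous_on_sum)
    fix l assume "l \<in> S"
    then have l: "l \<in> L" using SL by auto
    have "continuous_on {0..} (c l)"
      by (rule convex_on_nonneg_continuous) (use l c0 cnn cvx in auto)
    then show "continuous_on ?F (\<lambda>x. c l (x l))"
      by (rule continuous_on_compose2[OF _ coord]) (use l in \<open>auto simp: feasible_allocations_def\<close>)
  qed
  ultimately obtain x where x: "x \<in> ?F" "\<And>y. y \<in> ?F \<Longrightarrow> ?g x \<le> ?g y"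
    using continuous_attains_inf[OF _ ne] by blast
  have "auction_cost L t A X M c S = ereal (?g x)"
    unfolding auction_cost_def
    by (rule antisym) (use x in \<open>auto intro: INF_lower INF_greatest\<close>)
  then show thesis
    using x that by blast
qed

end

theory Submission
  imports Defs
begin

text \<open>
  Let \<open>x\<close> be optimal for \<open>S \<union> R\<close> and \<open>y\<close> optimal for \<open>S \<inter> R\<close>.  It suffices to redistribute the pair
  into allocations \<open>x'\<close> for \<open>S\<close> and \<open>y'\<close> for \<open>R\<close> with \<open>x' + y' = x + y\<close> and \<open>x'\<close> between \<open>x\<close> and
  \<open>y\<close> in every coordinate: convexity of the costs then gives the inequality coordinatewise.  Outside
  \<open>S \<inter> R\<close> the pair \<open>(x', y')\<close> is forced.  On \<open>S \<inter> R\<close> the demand constraints for \<open>x'\<close> bound its partial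
  sums from below by a supermodular function, and those for \<open>y'\<close> bound them from above by a
  submodular one, so that \<open>x'\<close> is provided by the discrete sandwich theorem.
\<close>

section \<open>Supermodular set functions and the discrete sandwich theorem\<close>

lemma supermodular_onD:
  "supermodular_on N f \<Longrightarrow> S \<subseteq> N \<Longrightarrow> R \<subseteq> N \<Longrightarrow> f S + f R \<le> f (S \<union> R) + f (S \<inter> R)"
  by (simp add: supermodular_on_def)

lemma supermodular_on_add_sum:
  fixes f :: "'a set \<Rightarrow> real"
  assumes "finite N" and f: "supermodular_on N f"
  shows "supermodular_on N (\<lambda>B. f B + sum w B)"
  unfolding supermodular_on_def
proof (intro allI impI)
  fix S R assume SR: "S \<subseteq> N" "R \<subseteq> N"
  then have "sum w (S \<union> R) + sum w (S \<inter> R) = sum w S + sum w R"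
    by (meson assms(1) finite_subset sum.union_inter)
  with supermodular_onD[OF f SR]
  show "f S + sum w S + (f R + sum w R) \<le> f (S \<union> R) + sum w (S \<union> R) + (f (S \<inter> R) + sum w (S \<inter> R))"
    by linarith
qed

text \<open>Eliminates the coordinate \<open>e\<close> once its weight \<open>w\<close> is fixed.
  Whichever branches attain the maxima for \<open>S\<close> and \<open>R\<close>, passing to union
  and intersection keeps the number of occurrences of \<open>e\<close>, so the terms
  \<open>w\<close> cancel.\<close>

lemma supermodular_on_project_insert:
  fixes f :: "'a set \<Rightarrow> real"
  assumes f: "supermodular_on (insert e N) f" and e: "e \<notin> N"
  shows "supermodular_on N (\<lambda>B. max (f B) (f (insert e B) - w))"
  unfolding supermodular_on_def
proof (intro allI impI)
  fix S R assume "S \<subseteq> N" "R \<subseteq> N"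
  then have sub: "S \<subseteq> insert e N" "R \<subseteq> insert e N"
      "insert e S \<subseteq> insert e N" "insert e R \<subseteq> insert e N"
    and eSR: "e \<notin> S" "e \<notin> R" using e by auto
  note D = supermodular_onD[OF f]
  have "f S + f R \<le> f (S \<union> R) + f (S \<inter> R)"
    using D[of S R] sub by simp
  moreover have "f (insert e S) + f (insert e R) \<le> f (insert e (S \<union> R)) + f (insert e (S \<inter> R))"
    using D[of "insert e S" "insert e R"] sub by simp
  moreover have "f (insert e S) + f R \<le> f (insert e (S \<union> R)) + f (S \<inter> R)"
    using D[of "insert e S" R] sub eSR by simp
  moreover have "f S + f (insert e R) \<le> f (insert e (S \<union> R)) + f (S \<inter> R)"
    using D[of S "insert e R"] sub eSR by simp
  ultimately
  show "max (f S) (f (insert e S) - w) + max (f R) (f (insert e R) - w)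
      \<le> max (f (S \<union> R)) (f (insert e (S \<union> R)) - w) + max (f (S \<inter> R)) (f (insert e (S \<inter> R)) - w)"
    by linarith
qed

text \<open>Frank's sandwich theorem for real weights. Induction adds one element: choose an
  admissible weight for it, then fold the bounds for \<open>B\<close> and \<open>insert e B\<close>
  into a single pair on \<open>N\<close>.\<close>

theorem discrete_sandwich:
  fixes f g :: "'a set \<Rightarrow> real"
  assumes "finite N"
    and "supermodular_on N f" and "supermodular_on N (\<lambda>B. - g B)"
    and "\<And>B. B \<subseteq> N \<Longrightarrow> f B \<le> g B" and "f {} = 0" and "g {} = 0"
  shows "\<exists>w. \<forall>B \<subseteq> N. f B \<le> sum w B \<and> sum w B \<le> g B"
  using assms
proof (induction N arbitrary: f g rule: finite_induct)
  case empty
  then show ?case by auto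
next
  case (insert e N)
  note f = insert.prems(1) and g = insert.prems(2) and fg = insert.prems(3)
  note e = \<open>e \<notin> N\<close>
  \<comment> \<open>The weight of \<open>e\<close> must lie above every
    \<open>f (insert e T) - g T\<close> and below every \<open>g (insert e Q) - f Q\<close>.
    Uncrossing for \<open>f\<close> and for \<open>g\<close> leads to the same sets
    \<open>insert e (T \<union> Q)\<close> and \<open>T \<inter> Q\<close>, where
    \<open>f \<le> g\<close>.\<close>
  have gap: "f (insert e T) - g T \<le> g (insert e Q) - f Q" if "T \<subseteq> N" "Q \<subseteq> N" for T Q
  proof -
    have sub: "insert e T \<subseteq> insert e N" "Q \<subseteq> insert e N" "T \<subseteq> insert e N"
        "insert e Q \<subseteq> insert e N" "insert e (T \<union> Q) \<subseteq> insert e N" "T \<inter> Q \<subseteq> insert e N"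
      and eTQ: "e \<notin> T" "e \<notin> Q" using that e by auto
    have "f (insert e T) + f Q \<le> f (insert e (T \<union> Q)) + f (T \<inter> Q)"
      using supermodular_onD[OF f, of "insert e T" Q] sub eTQ by simp
    also have "\<dots> \<le> g (insert e (T \<union> Q)) + g (T \<inter> Q)"
      by (intro add_mono fg sub)
    also have "\<dots> \<le> g T + g (insert e Q)"
      using supermodular_onD[OF g, of T "insert e Q"] sub eTQ by simp
    finally show ?thesis by simp
  qed
  define a where "a = Max ((\<lambda>T. f (insert e T) - g T) ` Pow N)"
  have a_ge: "f (insert e T) - g T \<le> a" if "T \<subseteq> N" for T
    unfolding a_def using that insert.hyps(1) by (intro Max_ge) auto
  have a_le: "a \<le> g (insert e Q) - f Q" if "Q \<subseteq> N" for Q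
    unfolding a_def using that insert.hyps(1) gap by (subst Max_le_iff) auto
  define f' where "f' B = max (f B) (f (insert e B) - a)" for B
  define g' where "g' B = min (g B) (g (insert e B) - a)" for B
  have "\<exists>w. \<forall>B \<subseteq> N. f' B \<le> sum w B \<and> sum w B \<le> g' B"
  proof (rule insert.IH)
    show "supermodular_on N f'"
      unfolding f'_def by (rule supermodular_on_project_insert[OF f e])
    have "(\<lambda>B. - g' B) = (\<lambda>B. max (- g B) (- g (insert e B) - (- a)))"
      by (auto simp: g'_def fun_eq_iff)
    then show "supermodular_on N (\<lambda>B. - g' B)"
      using supermodular_on_project_insert[OF g e, of "- a"] by simp
    \<comment> \<open>Of the four comparisons between branches, the two mixed ones are
      \<open>a_ge\<close> and \<open>a_le\<close>.\<close>
    show "f' B \<le> g' B" if "B \<subseteq> N" for B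
    proof -
      have "B \<subseteq> insert e N" "insert e B \<subseteq> insert e N" using that by auto
      then show ?thesis
        using fg[of B] fg[of "insert e B"] a_ge[OF that] a_le[OF that]
        unfolding f'_def g'_def by linarith
    qed
    show "f' {} = 0" "g' {} = 0"
      using a_ge[of "{}"] a_le[of "{}"] insert.prems(4,5) by (auto simp: f'_def g'_def)
  qed
  then obtain w where w: "\<And>B. B \<subseteq> N \<Longrightarrow> f' B \<le> sum w B \<and> sum w B \<le> g' B" by auto
  have "f B \<le> sum (w(e := a)) B \<and> sum (w(e := a)) B \<le> g B" if B: "B \<subseteq> insert e N" for B
  proof -
    let ?C = "B - {e}"
    have C: "?C \<subseteq> N" using B by auto
    then have fin: "finite ?C" using insert.hyps(1) finite_subset by blast
    have sumC: "sum (w(e := a)) ?C = sum w ?C" by (intro sum.cong) auto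
    show ?thesis
    proof (cases "e \<in> B")
      case True
      then have "insert e ?C = B" by auto
      moreover have "sum (w(e := a)) (insert e ?C) = a + sum w ?C"
        using fin sumC by (subst sum.insert) auto
      ultimately show ?thesis
        using w[OF C] by (auto simp: f'_def g'_def)
    next
      case False
      then have "?C = B" by auto
      then show ?thesis
        using w[OF C] sumC by (auto simp: f'_def g'_def)
    qed
  qed
  then show ?case by blast
qed

text \<open>Maximizers \<open>T\<close> for \<open>S\<close> and \<open>T'\<close> for
  \<open>R\<close> combine: since \<open>\<phi>\<close> preserves union and intersection,
  \<open>T \<union> T'\<close> competes for \<open>S \<union> R\<close> and
  \<open>T \<inter> T'\<close> for \<open>S \<inter> R\<close>. The empty set is always a
  candidate.\<close>

lemma supermodular_on_Max:
  fixes h :: "'b set \<Rightarrow> real"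
  assumes "finite K" and h: "supermodular_on K h"
    and empty: "\<phi> {} = {}"
    and un: "\<And>T T'. \<phi> (T \<union> T') = \<phi> T \<union> \<phi> T'"
    and int: "\<And>T T'. T \<subseteq> K \<Longrightarrow> T' \<subseteq> K \<Longrightarrow> \<phi> (T \<inter> T') = \<phi> T \<inter> \<phi> T'"
  shows "supermodular_on N (\<lambda>B. Max (h ` {T. T \<subseteq> K \<and> \<phi> T \<subseteq> B}))"
  unfolding supermodular_on_def
proof (intro allI impI)
  fix S R
  let ?D = "\<lambda>B. {T. T \<subseteq> K \<and> \<phi> T \<subseteq> B}"
  have fin: "finite (h ` ?D B)" and ne: "h ` ?D B \<noteq> {}" for B
    using \<open>finite K\<close> empty by auto
  obtain T T' where T: "T \<in> ?D S" "Max (h ` ?D S) = h T" and T': "T' \<in> ?D R" "Max (h ` ?D R) = h T'"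
    using Max_in[OF fin ne, of S] Max_in[OF fin ne, of R] by (auto simp: image_iff)
  have "T \<union> T' \<in> ?D (S \<union> R)" "T \<inter> T' \<in> ?D (S \<inter> R)"
    using T(1) T'(1) un int by auto
  then have "h (T \<union> T') \<le> Max (h ` ?D (S \<union> R))" "h (T \<inter> T') \<le> Max (h ` ?D (S \<inter> R))"
    by (simp_all only: Max_ge fin imageI)
  then show "Max (h ` ?D S) + Max (h ` ?D R) \<le> Max (h ` ?D (S \<union> R)) + Max (h ` ?D (S \<inter> R))"
    using supermodular_onD[OF h, of T T'] T T' by auto
qed

section \<open>Exchange between two feasible allocations\<close>

lemma allocation_exchange:
  assumes "finite L"
    and disj: "disjoint_family_on A {1..t}" and cover: "(\<Union>\<tau>\<in>{1..t}. A \<tau>) = L"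
    and M0: "M {} = 0" and M: "supermodular_on {1..t} M"
    and SR: "S \<subseteq> L" "R \<subseteq> L"
    and x: "x \<in> feasible_allocations L t A X M (S \<union> R)"
    and y: "y \<in> feasible_allocations L t A X M (S \<inter> R)"
  obtains x' y' where "x' \<in> feasible_allocations L t A X M S"
    and "y' \<in> feasible_allocations L t A X M R"
    and "\<And>l. x' l + y' l = x l + y l"
    and "\<And>l. min (x l) (y l) \<le> x' l" and "\<And>l. x' l \<le> max (x l) (y l)"
proof -
  define U where "U T = (\<Union>\<tau>\<in>T. A \<tau>)" for T
  let ?I = "S \<inter> R"
  have UL: "U T \<subseteq> L" if "T \<subseteq> {1..t}" for T
    using that cover unfolding U_def by auto
  have finU: "finite (U T)" if "T \<subseteq> {1..t}" for T
    using UL[OF that] \<open>finite L\<close> finite_subset by blast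
  have U0: "U {} = {}" and U_Un: "U (T \<union> T') = U T \<union> U T'" for T T'
    by (auto simp: U_def)
  \<comment> \<open>Here disjointness of the types enters: no bidder can lie in \<open>U T\<close>
    and \<open>U T'\<close> through different types.\<close>
  have U_Int: "U (T \<inter> T') = U T \<inter> U T'" if "T \<subseteq> {1..t}" "T' \<subseteq> {1..t}" for T T'
  proof -
    have "U T \<inter> U T' \<subseteq> U (T \<inter> T')"
    proof
      fix l assume "l \<in> U T \<inter> U T'"
      then obtain \<tau> \<sigma> where *: "\<tau> \<in> T" "\<sigma> \<in> T'" "l \<in> A \<tau>" "l \<in> A \<sigma>" by (auto simp: U_def)
      then have "\<tau> = \<sigma>"
        using disj that unfolding disjoint_family_on_def by blast
      then show "l \<in> U (T \<inter> T')" using * by (auto simp: U_def)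
    qed
    then show ?thesis by (auto simp: U_def)
  qed
  have x_out: "x l = 0" if "l \<notin> S \<union> R" for l
    using x that by (auto simp: feasible_allocations_def)
  have y_out: "y l = 0" if "l \<notin> ?I" for l
    using y that by (auto simp: feasible_allocations_def)
  have x0: "0 \<le> x l" and y0: "0 \<le> y l" for l
    using x y by (cases "l \<in> L"; force simp: feasible_allocations_def)+
  have xX: "x l \<le> X l" and yX: "y l \<le> X l" if "l \<in> L" for l
    using x y that by (auto simp: feasible_allocations_def)
  have xM: "M T \<le> sum x (U T)" and yM: "M T \<le> sum y (U T)" if "T \<subseteq> {1..t}" for T
    using x y that by (auto simp: feasible_allocations_def U_def)
  define lo where "lo l = min (x l) (y l)" for l
  define hi where "hi l = max (x l) (y l)" for l
  have lohi: "lo l \<le> hi l" "lo l + hi l = x l + y l" "0 \<le> lo l" for l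
    using x0[of l] y0[of l] by (auto simp: lo_def hi_def)
  define r where "r V l = (if l \<in> ?I then lo l else if l \<in> V then x l else 0)" for V l
  txt \<open>
    Any \<open>z\<close> that agrees with \<open>x\<close> on \<open>V - (S \<inter> R)\<close>, vanishes outside \<open>V\<close> and dominates \<open>lo\<close> on
    \<open>S \<inter> R\<close> exceeds \<open>r V\<close> only on \<open>S \<inter> R\<close>; \<open>H V B\<close> is the excess on \<open>B\<close> needed by the demands that
    can be topped up within \<open>B\<close>.
  \<close>
  define H where "H V B = Max ((\<lambda>T. M T - sum (r V) (U T)) ` {T. T \<subseteq> {1..t} \<and> U T \<inter> ?I \<subseteq> B})" for V B
  have H_ge: "M T - sum (r V) (U T) \<le> H V B" if "T \<subseteq> {1..t}" "U T \<inter> ?I \<subseteq> B" for V T B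
    unfolding H_def using that by (intro Max_ge) auto
  have H_nonneg: "0 \<le> H V B" for V B
    using H_ge[of "{}" B V] M0 U0 by simp
  have H_attained: "\<exists>T \<subseteq> {1..t}. U T \<inter> ?I \<subseteq> B \<and> H V B = M T - sum (r V) (U T)" for V B
  proof -
    have "H V B \<in> (\<lambda>T. M T - sum (r V) (U T)) ` {T. T \<subseteq> {1..t} \<and> U T \<inter> ?I \<subseteq> B}"
      unfolding H_def using U0 by (intro Max_in) auto
    then show ?thesis by auto
  qed
  have H_supermodular: "supermodular_on ?I (H V)" for V
  proof -
    have "supermodular_on {1..t} (\<lambda>T. M T - sum (r V) (U T))"
      unfolding supermodular_on_def
    proof (intro allI impI)
      fix T T' assume T: "T \<subseteq> {1..t}" "T' \<subseteq> {1..t}"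
      have "sum (r V) (U (T \<union> T')) + sum (r V) (U (T \<inter> T')) = sum (r V) (U T) + sum (r V) (U T')"
        using sum.union_inter[OF finU[OF T(1)] finU[OF T(2)]] by (simp add: U_Un U_Int[OF T])
      then show "M T - sum (r V) (U T) + (M T' - sum (r V) (U T'))
          \<le> M (T \<union> T') - sum (r V) (U (T \<union> T')) + (M (T \<inter> T') - sum (r V) (U (T \<inter> T')))"
        using supermodular_onD[OF M T] by linarith
    qed
    then show ?thesis
      unfolding H_def[abs_def] by (rule supermodular_on_Max[rotated]) (use U0 U_Un U_Int in auto)
  qed
  \<comment> \<open>This will place the lower bound \<open>H S + lo\<close> of the sandwich below
    the upper bound \<open>hi - H R\<close>.\<close>
  have H_sum: "H S B + H R B \<le> (\<Sum>l\<in>B. hi l - lo l)" if B: "B \<subseteq> ?I" for B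
  proof -
    obtain T where T: "T \<subseteq> {1..t}" "U T \<inter> ?I \<subseteq> B" "H S B = M T - sum (r S) (U T)"
      using H_attained by blast
    obtain T' where T': "T' \<subseteq> {1..t}" "U T' \<inter> ?I \<subseteq> B" "H R B = M T' - sum (r R) (U T')"
      using H_attained by blast
    have BL: "B \<subseteq> L" using B SR by auto
    have restr: "sum h C = (\<Sum>l\<in>L. if l \<in> C then h l else 0)" if "C \<subseteq> L" for C and h :: "'a \<Rightarrow> real"
      using sum.inter_restrict[OF \<open>finite L\<close>, of h C] that by (simp add: Int_absorb1)
    have "M T + M T' \<le> M (T \<union> T') + M (T \<inter> T')"
      by (rule supermodular_onD[OF M T(1) T'(1)])
    \<comment> \<open>The demands are crossed: \<open>y\<close>, which vanishes outside
      \<open>S \<inter> R\<close>, covers the union, and \<open>x\<close> the intersection.\<close>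
    also have "\<dots> \<le> sum y (U T \<union> U T') + sum x (U T \<inter> U T')"
      unfolding U_Un[symmetric] U_Int[OF T(1) T'(1), symmetric]
      by (intro add_mono yM xM) (use T(1) T'(1) in auto)
    also have "\<dots> = (\<Sum>l\<in>L. (if l \<in> U T \<union> U T' then y l else 0) + (if l \<in> U T \<inter> U T' then x l else 0))"
      using restr[of "U T \<union> U T'" y] restr[of "U T \<inter> U T'" x] UL[OF T(1)] UL[OF T'(1)]
      by (simp only: sum.distrib) auto
    \<comment> \<open>Off \<open>S \<inter> R\<close>, \<open>y\<close> is zero and
      \<open>r S + r R = x\<close>. On \<open>S \<inter> R\<close>, any bidder counted on the left
      lies in \<open>B\<close>, and \<open>hi - lo\<close> fills the gap:
      \<open>lo + hi = x + y\<close> if it is in both sets, \<open>y \<le> hi\<close> if in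
      one.\<close>
    also have "\<dots> \<le> (\<Sum>l\<in>L. (if l \<in> U T then r S l else 0) + (if l \<in> U T' then r R l else 0)
        + (if l \<in> B then hi l - lo l else 0))"
    proof (rule sum_mono)
      fix l assume "l \<in> L"
      have "y l \<le> hi l" by (simp add: hi_def)
      then show "(if l \<in> U T \<union> U T' then y l else 0) + (if l \<in> U T \<inter> U T' then x l else 0)
          \<le> (if l \<in> U T then r S l else 0) + (if l \<in> U T' then r R l else 0)
        + (if l \<in> B then hi l - lo l else 0)"
        using lohi[of l] T(2) T'(2) B x_out[of l] y_out[of l] x0[of l]
        by (auto simp: r_def)
    qed
    also have "\<dots> = sum (r S) (U T) + sum (r R) (U T') + (\<Sum>l\<in>B. hi l - lo l)"
      using restr[OF UL[OF T(1)]] restr[OF UL[OF T'(1)]] restr[OF BL] by (simp add: sum.distrib)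
    finally show ?thesis using T(3) T'(3) by linarith
  qed
  have finI: "finite ?I" using SR \<open>finite L\<close> finite_subset by blast
  have "H S {} = 0" "H R {} = 0"
    using H_sum[of "{}"] H_nonneg[of S "{}"] H_nonneg[of R "{}"] by auto
  then have zero: "H S {} + sum lo {} = 0" "sum hi {} - H R {} = 0"
    by simp_all
  have sub: "supermodular_on ?I (\<lambda>B. - (sum hi B - H R B))"
    using supermodular_on_add_sum[OF finI H_supermodular[of R], of "\<lambda>l. - hi l"]
    by (simp add: sum_negf)
  have le: "H S B + sum lo B \<le> sum hi B - H R B" if "B \<subseteq> ?I" for B
    using H_sum[OF that] by (simp add: sum_subtractf)
  \<comment> \<open>\<open>w\<close> gives the values of \<open>x'\<close> on
    \<open>S \<inter> R\<close>: the lower bound encodes the demands on \<open>x'\<close>, the upper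
    bound those on \<open>y' = x + y - w\<close>.\<close>
  obtain w where
    w_ge: "\<And>B. B \<subseteq> ?I \<Longrightarrow> H S B + sum lo B \<le> sum w B" and
    w_le: "\<And>B. B \<subseteq> ?I \<Longrightarrow> sum w B \<le> sum hi B - H R B"
    using discrete_sandwich[OF finI supermodular_on_add_sum[OF finI H_supermodular] sub le zero]
    by blast
  \<comment> \<open>Singletons suffice, because \<open>H\<close> is nonnegative.\<close>
  have w: "lo l \<le> w l" "w l \<le> hi l" if "l \<in> ?I" for l
    using w_ge[of "{l}"] w_le[of "{l}"] H_nonneg[of S "{l}"] H_nonneg[of R "{l}"] that by auto
  have split: "sum h (U T) = sum h (U T \<inter> ?I) + sum h (U T - ?I)"
    if "T \<subseteq> {1..t}" for T and h :: "'a \<Rightarrow> real"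
    using sum.Int_Diff[OF finU[OF that]] .
  have feasible: "z \<in> feasible_allocations L t A X M V"
    if V: "V = S \<or> V = R"
      and z: "z = (\<lambda>l. if l \<in> ?I then v l else if l \<in> V then x l else 0)"
      and v_ge: "\<And>B. B \<subseteq> ?I \<Longrightarrow> H V B + sum lo B \<le> sum v B"
      and v: "\<And>l. l \<in> ?I \<Longrightarrow> lo l \<le> v l \<and> v l \<le> hi l" for z v V
  proof -
    have "M T \<le> sum z (U T)" if T: "T \<subseteq> {1..t}" for T
    proof -
      have rz: "sum (r V) (U T - ?I) = sum z (U T - ?I)"
        by (rule sum.cong) (auto simp: r_def z)
      have rlo: "sum (r V) (U T \<inter> ?I) = sum lo (U T \<inter> ?I)"
        by (rule sum.cong) (auto simp: r_def)
      have zv: "sum z (U T \<inter> ?I) = sum v (U T \<inter> ?I)"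
        by (rule sum.cong) (auto simp: z)
      have "M T \<le> sum (r V) (U T) + H V (U T \<inter> ?I)"
        using H_ge[OF T, of "U T \<inter> ?I" V] by simp
      also have "\<dots> = sum lo (U T \<inter> ?I) + H V (U T \<inter> ?I) + sum z (U T - ?I)"
        using split[OF T, of "r V"] rz rlo by simp
      also have "\<dots> \<le> sum v (U T \<inter> ?I) + sum z (U T - ?I)"
        using v_ge[OF Int_lower2, of "U T"] by simp
      also have "\<dots> = sum z (U T)"
        using split[OF T, of z] zv by simp
      finally show ?thesis .
    qed
    moreover have "0 \<le> z l" for l
      using v[of l] lohi[of l] x0[of l] by (auto simp: z)
    moreover have "z l \<le> X l" if "l \<in> L" for l
      using v[of l] xX[OF that] yX[OF that] x0[of l] by (auto simp: z hi_def)
    moreover have "z l = 0" if "l \<notin> V \<or> l \<notin> L" for l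
      using that V SR by (auto simp: z)
    ultimately show ?thesis
      unfolding feasible_allocations_def U_def by auto
  qed
  define x' where "x' = (\<lambda>l. if l \<in> ?I then w l else if l \<in> S then x l else 0)"
  define y' where "y' = (\<lambda>l. if l \<in> ?I then x l + y l - w l else if l \<in> R then x l else 0)"
  show thesis
  proof
    show "x' \<in> feasible_allocations L t A X M S"
      by (rule feasible[OF _ x'_def]) (use w w_ge in auto)
    show "y' \<in> feasible_allocations L t A X M R"
    proof (rule feasible[OF _ y'_def])
      \<comment> \<open>As \<open>x + y = lo + hi\<close>, this is \<open>w_le\<close>
        rearranged.\<close>
      show "H R B + sum lo B \<le> (\<Sum>l\<in>B. x l + y l - w l)" if "B \<subseteq> ?I" for B
        using w_le[OF that] by (simp add: lohi(2)[symmetric] sum.distrib sum_subtractf)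
      show "lo l \<le> x l + y l - w l \<and> x l + y l - w l \<le> hi l" if "l \<in> ?I" for l
        using w[OF that] lohi(2)[of l] by auto
    qed simp
    fix l
    show "x' l + y' l = x l + y l"
      using x_out[of l] y_out[of l] by (auto simp: x'_def y'_def)
    show "min (x l) (y l) \<le> x' l" "x' l \<le> max (x l) (y l)"
      using w[of l] x_out[of l] y_out[of l] x0[of l] by (auto simp: x'_def lo_def hi_def)
  qed
qed

section \<open>Convex costs and supermodularity of the optimal cost\<close>

lemma convex_on_sum_between:
  fixes f :: "real \<Rightarrow> real"
  assumes f: "convex_on C f" and C: "x \<in> C" "y \<in> C"
    and sum: "x' + y' = x + y" and between: "min x y \<le> x'" "x' \<le> max x y"
  shows "f x' + f y' \<le> f x + f y"
proof (cases "x = y")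
  case True
  then show ?thesis using sum between by auto
next
  case False
  \<comment> \<open>The position of \<open>x'\<close> on the segment from \<open>x\<close> to
    \<open>y\<close>; the equal sums make \<open>y'\<close> its mirror image, so the weights in the
    two convexity inequalities add up to one.\<close>
  define u where "u = (x' - x) / (y - x)"
  have u: "0 \<le> u" "u \<le> 1"
    using False between by (auto simp: u_def min_def max_def divide_simps split: if_splits)
  have "u * (y - x) = x' - x" using False by (simp add: u_def)
  then have x': "x' = (1 - u) * x + u * y" and y': "y' = (1 - u) * y + u * x"
    using sum by (simp_all add: algebra_simps)
  show ?thesis
    using convex_onD[OF f u C] convex_onD[OF f u C(2,1)]
    unfolding x' y' by (simp add: algebra_simps)
qed

theorem theorem5:
  fixes L :: "'a set" and t :: nat and A :: "nat \<Rightarrow> 'a set"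
    and X :: "'a \<Rightarrow> real" and M :: "nat set \<Rightarrow> real" and c :: "'a \<Rightarrow> real \<Rightarrow> real"
  assumes "finite L"
    and "disjoint_family_on A {1..t}" and "(\<Union>\<tau>\<in>{1..t}. A \<tau>) = L"
    and "\<And>l. l \<in> L \<Longrightarrow> 0 \<le> X l"
    and "\<And>l x. l \<in> L \<Longrightarrow> 0 \<le> x \<Longrightarrow> 0 \<le> c l x"
    and "\<And>l. l \<in> L \<Longrightarrow> c l 0 = 0"
    and "\<And>T. T \<subseteq> {1..t} \<Longrightarrow> 0 \<le> M T"
    and "M {} = 0"
    and "\<And>l. l \<in> L \<Longrightarrow> mono_on {0..} (c l)"
    and "\<And>l. l \<in> L \<Longrightarrow> convex_on {0..} (c l)"
    and "supermodular_on {1..t} M"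
    and "mono_on (Pow {1..t}) M"
  shows "supermodular_on L (auction_cost L t A X M c)"
  unfolding supermodular_on_def
proof (intro allI impI)
  fix S R assume SR: "S \<subseteq> L" "R \<subseteq> L"
  let ?F = "feasible_allocations L t A X M" and ?J = "auction_cost L t A X M c"
  have UI: "S \<union> R \<subseteq> L" "S \<inter> R \<subseteq> L" using SR by auto
  show "?J S + ?J R \<le> ?J (S \<union> R) + ?J (S \<inter> R)"
  proof (cases "?F (S \<union> R) = {} \<or> ?F (S \<inter> R) = {}")
    case True
    then show ?thesis by (auto simp: auction_cost_infeasible)
  next
    case False
    then have ne: "?F (S \<union> R) \<noteq> {}" "?F (S \<inter> R) \<noteq> {}" by auto
    obtain x where x: "x \<in> ?F (S \<union> R)" "?J (S \<union> R) = ereal (\<Sum>l\<in>S \<union> R. c l (x l))"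
      by (rule auction_cost_attained[OF UI(1) assms(6,5,10) ne(1)])
    obtain y where y: "y \<in> ?F (S \<inter> R)" "?J (S \<inter> R) = ereal (\<Sum>l\<in>S \<inter> R. c l (y l))"
      by (rule auction_cost_attained[OF UI(2) assms(6,5,10) ne(2)])
    obtain x' y' where x': "x' \<in> ?F S" and y': "y' \<in> ?F R"
      and sum: "\<And>l. x' l + y' l = x l + y l"
      and between: "\<And>l. min (x l) (y l) \<le> x' l" "\<And>l. x' l \<le> max (x l) (y l)"
      using allocation_exchange[OF assms(1-3,8,11) SR x(1) y(1)] by blast
    \<comment> \<open>Since \<open>c l 0 = 0\<close>, all four costs become sums over
      \<open>L\<close> and can be compared bidder by bidder.\<close>
    have cost: "(\<Sum>l\<in>V. c l (z l)) = (\<Sum>l\<in>L. c l (z l))" if "z \<in> ?F V" "V \<subseteq> L" for z V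
      using that assms(1,6) by (intro sum.mono_neutral_left) (auto simp: feasible_allocations_def)
    have "(\<Sum>l\<in>S. c l (x' l)) + (\<Sum>l\<in>R. c l (y' l)) = (\<Sum>l\<in>L. c l (x' l) + c l (y' l))"
      using cost[OF x' SR(1)] cost[OF y' SR(2)] by (simp add: sum.distrib)
    also have "\<dots> \<le> (\<Sum>l\<in>L. c l (x l) + c l (y l))"
    proof (rule sum_mono)
      fix l assume l: "l \<in> L"
      then have "x l \<in> {0..}" "y l \<in> {0..}"
        using x(1) y(1) by (auto simp: feasible_allocations_def)
      then show "c l (x' l) + c l (y' l) \<le> c l (x l) + c l (y l)"
        by (intro convex_on_sum_between[OF assms(10)[OF l]] sum between)
    qed
    also have "\<dots> = (\<Sum>l\<in>S \<union> R. c l (x l)) + (\<Sum>l\<in>S \<inter> R. c l (y l))"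
      using cost[OF x(1) UI(1)] cost[OF y(1) UI(2)] by (simp add: sum.distrib)
    finally have le: "ereal (\<Sum>l\<in>S. c l (x' l)) + ereal (\<Sum>l\<in>R. c l (y' l)) \<le> ?J (S \<union> R) + ?J (S \<inter> R)"
      using x(2) y(2) by simp
    \<comment> \<open>For \<open>S\<close> and \<open>R\<close> feasibility is enough, as
      \<open>auction_cost\<close> is an infimum.\<close>
    have "?J S \<le> ereal (\<Sum>l\<in>S. c l (x' l))" "?J R \<le> ereal (\<Sum>l\<in>R. c l (y' l))"
      unfolding auction_cost_def using x' y' by (auto intro: INF_lower)
    then show ?thesis
      using le by (meson add_mono order_trans)
  qed
qed

end
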